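(* The following hold, where $n$ denotes an integer: (i) $N(n,5) = \dfrac{32}{3}n^3 - 89n^2 + \dfrac{739}{3}n - 220$ for all $n \geq 5$. (ii) $N(n,6) = \dfrac{181}{12}n^4 - \dfrac{401}{2}n^3 + \dfrac{11783}{12}n^2 - \dfrac{4153}{2}n + 1590$ for all $n \geq 6$. (iii) $N(n,7)= \dfrac{607}{30}n^5 - \dfrac{4675}{12}n^4 + \dfrac{8807}{3}n^3 - \dfrac{129041}{12}n^2 + \dfrac{190471}{10}n - 12978$ for all $n \geq 7$.
   Context: Let $[n]=\{1,\dots,n\}$ and let $S_n$ be the group of all permutations of $[n]$; $i^\sigma$ denotes the image of $i$ under $\sigma$, and composition is $i^{\sigma\tau}=(i^\sigma)^\tau$. For $\sigma\in S_n$ let $M(\sigma)=\{i\in[n] : i^\sigma\neq i\}$. The Hamming distance of $\sigma,\pi\in S_n$ is $d(\sigma,\pi)=|M(\sigma\pi^{-1})|$. The Hamming ball of radius $r$ centered at $\sigma$ is $B_r^n(\sigma)=\{\pi\in S_n : d(\sigma,\pi)\le r\}$. Define $$N(n,r)=\max\{\,|B_r^n(\pi)\cap B_r^n(\tau)| : \pi,\tau\in S_n,\ d(\pi,\tau)\ge 2\,\}.$$ *)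

theory Defs
  imports Complex_Main "HOL-Combinatorics.Permutations"
begin

text \<open>Elements of the symmetric group on \<open>{1..n}\<close> are functions \<open>p\<close> with
  \<open>p permutes {1..n}\<close>; the image of \<open>i\<close> under \<open>p\<close> is \<open>p i\<close>.\<close>

definition sym_group :: "nat \<Rightarrow> (nat \<Rightarrow> nat) set" where
  "sym_group n = {p. p permutes {1..n}}"

text \<open>Permutations act on the right: in the product of \<open>s\<close> and \<open>t\<close>, \<open>s\<close> is applied first.\<close>

definition perm_mult :: "(nat \<Rightarrow> nat) \<Rightarrow> (nat \<Rightarrow> nat) \<Rightarrow> nat \<Rightarrow> nat" where
  "perm_mult s t = t \<circ> s"

definition moved :: "nat \<Rightarrow> (nat \<Rightarrow> nat) \<Rightarrow> nat set" where
  "moved n s = {i \<in> {1..n}. s i \<noteq> i}"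

definition hamming_dist :: "nat \<Rightarrow> (nat \<Rightarrow> nat) \<Rightarrow> (nat \<Rightarrow> nat) \<Rightarrow> nat" where
  "hamming_dist n s p = card (moved n (perm_mult s (inv p)))"

definition hamming_ball :: "nat \<Rightarrow> nat \<Rightarrow> (nat \<Rightarrow> nat) \<Rightarrow> (nat \<Rightarrow> nat) set" where
  "hamming_ball n r s = {p \<in> sym_group n. hamming_dist n s p \<le> r}"

text \<open>The maximum ranges over a finite set, which is nonempty exactly when \<open>n \<ge> 2\<close>;
  for \<open>n < 2\<close> the value is unspecified.\<close>

definition max_ball_inter :: "nat \<Rightarrow> nat \<Rightarrow> nat" where
  "max_ball_inter n r =
     Max {card (hamming_ball n r p \<inter> hamming_ball n r t) | p t.
            p \<in> sym_group n \<and> t \<in> sym_group n \<and> hamming_dist n p t \<ge> 2}"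

end

theory Submission
  imports Defs
begin

text \<open>By translation the problem is to maximise, over permutations \<open>g\<close> different from the
  identity, the number of permutations that are within \<open>r\<close> of both the identity and \<open>g\<close>. For a
  transposition \<open>(x y)\<close> these are exactly the permutations moving at most \<open>r - 2\<close> points outside
  \<open>{x, y}\<close>, and they are counted by the set of those points.

  For general \<open>g\<close> with support \<open>M\<close>, choose \<open>x, y\<close> in \<open>M\<close>, sort the permutations by the set \<open>K\<close>
  of points they move outside \<open>M\<close>, and compare with the permutations moving at most \<open>r - 2\<close> points
  outside \<open>{x, y}\<close>, block by block. If \<open>|M| + |K| \<le> r\<close>, the comparison block contains every
  permutation. If \<open>|M| + |K| = r + u\<close> with \<open>u > 0\<close>, each permutation \<open>p\<close> close to \<open>g\<close> agrees with
  \<open>g\<close> at \<open>u\<close> or more points \<open>i\<close> of \<open>M\<close>, and then lies in the comparison block of the pair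
  \<open>i, g i\<close>; a switching argument shows that at most a fraction \<open>1/r\<close> of that block maps \<open>i\<close> to
  \<open>g i\<close>. Hence the ratio of the two blocks is at most \<open>|M| / (u r) \<le> 1\<close>, unless \<open>u = 1\<close>,
  \<open>K = {}\<close> and \<open>|M| = r + 1\<close>. In that case the claim reduces, by inclusion-exclusion, to a
  lower bound on the number of derangements of \<open>M\<close> that agree with \<open>g\<close> somewhere, for which three
  points of \<open>M\<close> suffice because \<open>|M| \<ge> 6\<close>.\<close>

section \<open>Blocks of permutations and derangement-like counts\<close>

definition moving_perms :: "'a set \<Rightarrow> 'a set \<Rightarrow> ('a \<Rightarrow> 'a) set" where
  "moving_perms M K = {p. p permutes (M \<union> K) \<and> (\<forall>i\<in>K. p i \<noteq> i)}"

text \<open>Intended for \<open>K\<close> disjoint from \<open>M\<close>: the block of permutations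
  moving exactly \<open>K\<close> outside \<open>M\<close> and at most \<open>r - 2\<close> points
  outside the pair. The additive form avoids truncated subtraction.\<close>

definition fixing_off_pair :: "'a set \<Rightarrow> 'a set \<Rightarrow> nat \<Rightarrow> 'a \<Rightarrow> 'a \<Rightarrow> ('a \<Rightarrow> 'a) set" where
  "fixing_off_pair M K r x y =
     {p \<in> moving_perms M K. card K + 2 + card {i \<in> M - {x, y}. p i \<noteq> i} \<le> r}"

text \<open>With \<open>g\<close> supported on \<open>M\<close> and \<open>K\<close> disjoint from
  \<open>M\<close>, each point of \<open>K\<close> is moved and counts once towards both distances,
  to the identity and to \<open>g\<close>.\<close>

definition close_to_both :: "'a set \<Rightarrow> 'a set \<Rightarrow> nat \<Rightarrow> ('a \<Rightarrow> 'a) \<Rightarrow> ('a \<Rightarrow> 'a) set" where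
  "close_to_both M K r g =
     {p \<in> moving_perms M K. card K + card {i \<in> M. p i \<noteq> i} \<le> r
                          \<and> card K + card {i \<in> M. p i \<noteq> g i} \<le> r}"

text \<open>The difference table of the factorials. For \<open>k \<le> n\<close> an entry counts the
  permutations of \<open>n\<close> points that fix none of \<open>k\<close> given points; the
  subtraction is then one of nested sets, so truncation loses nothing.\<close>

fun partial_derangements :: "nat \<Rightarrow> nat \<Rightarrow> nat" where
  "partial_derangements n 0 = fact n"
| "partial_derangements n (Suc k) = partial_derangements n k - partial_derangements (n - 1) k"

lemma partial_derangements_numeral:
  "partial_derangements n (numeral k) =
     partial_derangements n (pred_numeral k) - partial_derangements (n - 1) (pred_numeral k)"
  by (simp add: numeral_eq_Suc)

lemma permutes_Diff_iff: "p permutes (V - {z}) \<longleftrightarrow> p permutes V \<and> p z = z"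
proof
  assume p: "p permutes (V - {z})"
  have "p permutes V" by (rule permutes_subset[OF p]) blast
  moreover have "p z = z" using p by (rule permutes_not_in) simp
  ultimately show "p permutes V \<and> p z = z" by simp
next
  assume p: "p permutes V \<and> p z = z"
  show "p permutes (V - {z})"
    by (rule permutes_superset[of p V]) (use p in auto)
qed

lemma finite_moving_perms: "finite M \<Longrightarrow> finite K \<Longrightarrow> finite (moving_perms M K)"
  unfolding moving_perms_def
  by (rule finite_subset[OF _ finite_permutations[of "M \<union> K"]]) auto

text \<open>The permutations to be discarded when \<open>z\<close> joins \<open>K\<close> are those
  fixing \<open>z\<close>, which are the permutations of \<open>V - {z}\<close> with the same
  condition on \<open>K\<close>. Hence the induction varies \<open>V\<close>.\<close>

lemma card_partial_derangements:
  assumes "finite K" "finite V" "K \<subseteq> V"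
  shows "card {p. p permutes V \<and> (\<forall>i\<in>K. p i \<noteq> i)} = partial_derangements (card V) (card K)"
  using assms
proof (induction K arbitrary: V rule: finite_induct)
  case empty
  then show ?case by (simp add: card_permutations)
next
  case (insert z K)
  let ?A = "\<lambda>V. {p. p permutes V \<and> (\<forall>i\<in>K. p i \<noteq> i)}"
  have fin: "finite (?A V)"
    by (rule finite_subset[OF _ finite_permutations[OF insert.prems(1)]]) auto
  have eq: "{p. p permutes V \<and> (\<forall>i\<in>insert z K. p i \<noteq> i)} = ?A V - ?A (V - {z})"
    by (auto simp: permutes_Diff_iff)
  have sub: "?A (V - {z}) \<subseteq> ?A V"
    by (auto simp: permutes_Diff_iff)
  have 1: "card (?A V) = partial_derangements (card V) (card K)"
    using insert by auto
  have 2: "card (?A (V - {z})) = partial_derangements (card (V - {z})) (card K)"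
    using insert by (intro insert.IH) auto
  have 3: "card (V - {z}) = card V - 1" using insert by auto
  show ?case
    unfolding eq using insert.hyps 1 2 3
    by (simp add: card_Diff_subset[OF finite_subset[OF sub fin] sub])
qed

lemma card_moving_perms:
  assumes "finite M" "finite K" "M \<inter> K = {}"
  shows "card (moving_perms M K) = partial_derangements (card M + card K) (card K)"
  using card_partial_derangements[of K "M \<union> K"] assms
  by (simp add: moving_perms_def card_Un_disjoint)

section \<open>Switching\<close>

text \<open>The switched permutation takes the value \<open>y\<close> exactly at \<open>w\<close>,
  so it determines \<open>w\<close>; undoing the swap then recovers \<open>p\<close>.\<close>

lemma switch_injective:
  assumes "\<And>p. p \<in> P \<Longrightarrow> inj p \<and> p x = y"
  shows "inj_on (\<lambda>(p, w). p \<circ> transpose x w) (Sigma P W)"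
proof (rule inj_onI, clarify)
  fix p w q v
  assume p: "p \<in> P" and q: "q \<in> P" and e: "p \<circ> transpose x w = q \<circ> transpose x v"
  have "(p \<circ> transpose x w) w = y" "(q \<circ> transpose x v) v = y"
    using assms p q by auto
  then have eq: "(p \<circ> transpose x w) w = (p \<circ> transpose x w) v"
    unfolding e by simp
  have "inj (p \<circ> transpose x w)"
    using assms[OF p] by (intro inj_compose) auto
  then have "w = v" using eq by (rule injD)
  moreover from this have "p = q"
    using arg_cong[OF e, of "\<lambda>f. f \<circ> transpose x w"] by (simp add: comp_assoc)
  ultimately show "p = q \<and> w = v" by simp
qed

lemma switch_card:
  assumes "finite P" "finite T" "\<And>p. p \<in> P \<Longrightarrow> inj p \<and> p x = y"
    and "\<And>p. p \<in> P \<Longrightarrow> finite (W p) \<and> r \<le> card (W p)"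
    and "\<And>p w. p \<in> P \<Longrightarrow> w \<in> W p \<Longrightarrow> p \<circ> transpose x w \<in> T"
  shows "r * card P \<le> card T"
proof -
  have "r * card P \<le> (\<Sum>p\<in>P. card (W p))"
    using sum_bounded_below[of P r "\<lambda>p. card (W p)"] assms(4) by (simp add: mult.commute)
  also have "\<dots> = card (Sigma P W)"
    using assms by (subst card_SigmaI) auto
  also have "\<dots> \<le> card T"
    by (rule card_inj_on_le[OF switch_injective[of P x y] _ assms(2)]) (use assms in auto)
  finally show ?thesis .
qed

text \<open>Precomposing \<open>p\<close> with the swap of \<open>x\<close> and \<open>w\<close>
  stays in the block for at least \<open>r\<close> choices of \<open>w\<close>, and all results are
  distinct. The choice \<open>w = x\<close>, giving \<open>p\<close> itself, is included.\<close>

lemma fixing_off_pair_switch: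
  assumes fin: "finite M" "finite K" and dj: "M \<inter> K = {}"
    and xy: "x \<in> M" "y \<in> M" "x \<noteq> y" and r: "r \<le> card M + card K"
  shows "r * card {p \<in> fixing_off_pair M K r x y. p x = y} \<le> card (fixing_off_pair M K r x y)"
proof -
  define T where "T = fixing_off_pair M K r x y"
  define mv where "mv p = {i \<in> M - {x, y}. p i \<noteq> i}" for p :: "'a \<Rightarrow> 'a"
  \<comment> \<open>Switching at a point fixed by \<open>p\<close> makes it move, which is affordable only if the bound is not tight.\<close>
  define W where "W p = (if card K + 2 + card (mv p) = r then {i \<in> M \<union> K. p i \<noteq> i} else M \<union> K)"
    for p :: "'a \<Rightarrow> 'a"
  have finmv: "finite (mv p)" for p using fin by (simp add: mv_def)
  have T: "p \<in> T \<longleftrightarrow> p permutes (M \<union> K) \<and> (\<forall>i\<in>K. p i \<noteq> i) \<and> card K + 2 + card (mv p) \<le> r" for p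
    by (auto simp: T_def fixing_off_pair_def moving_perms_def mv_def)
  have finT: "finite T"
    unfolding T_def fixing_off_pair_def using finite_moving_perms[OF fin] by auto
  have "r * card {p \<in> T. p x = y} \<le> card T"
  proof (rule switch_card[where W = W and x = x and y = y])
    fix p assume p: "p \<in> {p \<in> T. p x = y}"
    then have perm: "p permutes (M \<union> K)" and pK: "\<forall>i\<in>K. p i \<noteq> i" and px: "p x = y"
      and pr: "card K + 2 + card (mv p) \<le> r" using T by auto
    have inj: "inj p" using perm by (rule permutes_inj)
    then show "inj p \<and> p x = y" using px by simp
    have py: "p y \<noteq> y" using injD[OF inj, of x y] px xy by auto
    \<comment> \<open>Both \<open>x\<close> and \<open>y\<close> are moved, so in the tight case
      \<open>p\<close> moves exactly \<open>r\<close> points and \<open>W p\<close> still has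
      \<open>r\<close> elements.\<close>
    have "{i \<in> M \<union> K. p i \<noteq> i} = insert x (insert y (mv p \<union> K))"
      using pK px py xy by (auto simp: mv_def)
    moreover have "x \<notin> insert y (mv p \<union> K)" "y \<notin> mv p \<union> K" "mv p \<inter> K = {}"
      using xy dj by (auto simp: mv_def)
    then have "card (insert x (insert y (mv p \<union> K))) = card K + 2 + card (mv p)"
      using fin finmv by (simp add: card_Un_disjoint)
    ultimately show "finite (W p) \<and> r \<le> card (W p)"
      using fin r dj by (auto simp: W_def card_Un_disjoint)
    fix w assume w: "w \<in> W p"
    then have wV: "w \<in> M \<union> K" by (auto simp: W_def split: if_splits)
    let ?q = "p \<circ> transpose x w"
    have q: "?q permutes (M \<union> K)"
      using wV xy by (intro permutes_compose[OF permutes_swap_id perm]) auto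
    \<comment> \<open>Only the images of \<open>x\<close> and \<open>w\<close> change:
      \<open>x\<close> is outside \<open>K\<close>, and \<open>w\<close> receives \<open>y\<close>,
      which is outside \<open>K\<close>.\<close>
    have qK: "?q i \<noteq> i" if "i \<in> K" for i
      using that pK px xy dj by (auto simp: transpose_def)
    have sub: "mv ?q \<subseteq> insert w (mv p)"
      by (auto simp: mv_def transpose_def)
    have "card K + 2 + card (mv ?q) \<le> r"
    proof (cases "card K + 2 + card (mv p) = r")
      case True
      then have "p w \<noteq> w" using w by (simp add: W_def)
      then have "mv ?q \<subseteq> mv p" using sub by (auto simp: mv_def)
      then show ?thesis using card_mono[OF finmv] pr by (meson add_left_mono order_trans)
    next
      case False
      have "card (mv ?q) \<le> Suc (card (mv p))"
        using card_mono[OF _ sub] finmv card_insert_le_m1[of "Suc (card (mv p))" "mv p" w]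
        by (simp add: card_insert_if split: if_splits)
      then show ?thesis using False pr by simp
    qed
    then show "?q \<in> T" using T q qK by simp
  qed (use finT in auto)
  then show ?thesis by (simp add: T_def)
qed

section \<open>Relabelling by conjugation\<close>

text \<open>Double transitivity by two swaps: the first takes \<open>x\<close> to \<open>x'\<close>
  and \<open>y\<close> to some \<open>?z\<close>, the second takes \<open>?z\<close> to
  \<open>y'\<close> without disturbing \<open>x'\<close>.\<close>

lemma permutes_moving_pair:
  assumes "x \<in> M" "y \<in> M" "x \<noteq> y" "x' \<in> M" "y' \<in> M" "x' \<noteq> y'"
  obtains h where "h permutes M" "h x = x'" "h y = y'"
proof
  let ?z = "transpose x x' y"
  have z: "?z \<in> M" "?z \<noteq> x'" using assms by (auto simp: transpose_def)
  show "(transpose ?z y' \<circ> transpose x x') permutes M"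
    using assms z by (intro permutes_compose permutes_swap_id) auto
  show "(transpose ?z y' \<circ> transpose x x') x = x'"
    using assms z by (simp add: transpose_apply_other)
  show "(transpose ?z y' \<circ> transpose x x') y = y'"
    by simp
qed

lemma card_conjugate_le:
  assumes "bij h" "finite Q" "\<And>p. p \<in> P \<Longrightarrow> h \<circ> p \<circ> inv h \<in> Q"
  shows "card P \<le> card Q"
proof (rule card_inj_on_le[OF _ _ assms(2)])
  show "inj_on (\<lambda>p. h \<circ> p \<circ> inv h) P"
  proof (rule inj_onI)
    fix p q assume e: "h \<circ> p \<circ> inv h = h \<circ> q \<circ> inv h"
    have "h (p i) = h (q i)" for i
      using fun_cong[OF e, of "h i"] assms(1) by (simp add: bij_is_inj)
    then show "p = q" using assms(1) by (auto simp: bij_def inj_eq)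
  qed
qed (use assms in auto)

text \<open>Conjugation by a permutation of \<open>M\<close> carrying one pair to the other fixes
  \<open>K\<close> pointwise and preserves the number of moved points off the pair. As the pairs can
  be exchanged, the block size does not depend on the pair.\<close>

lemma card_fixing_off_pair_le:
  assumes fin: "finite M" "finite K" and dj: "M \<inter> K = {}"
    and xy: "x \<in> M" "y \<in> M" "x \<noteq> y" "x' \<in> M" "y' \<in> M" "x' \<noteq> y'"
  shows "card (fixing_off_pair M K r x y) \<le> card (fixing_off_pair M K r x' y')"
proof -
  obtain h where h: "h permutes M" "h x = x'" "h y = y'"
    using permutes_moving_pair[OF xy] .
  have hb: "bij h" using h by (simp add: permutes_bij)
  have hV: "h permutes (M \<union> K)" using h by (auto intro: permutes_subset)
  show ?thesis
  proof (rule card_conjugate_le[OF hb])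
    show "finite (fixing_off_pair M K r x' y')"
      using finite_moving_perms[OF fin] by (auto simp: fixing_off_pair_def)
    fix p assume p: "p \<in> fixing_off_pair M K r x y"
    let ?q = "h \<circ> p \<circ> inv h"
    have 1: "?q permutes (M \<union> K)"
      using p hV by (auto simp: fixing_off_pair_def moving_perms_def intro!: permutes_compose permutes_inv)
    have 2: "?q i \<noteq> i" if "i \<in> K" for i
    proof -
      have "i \<notin> M" using that dj by auto
      then have "h i = i" "inv h i = i" using h(1) by (auto simp: permutes_not_in permutes_inv_eq)
      then show ?thesis
        using p that injD[OF bij_is_inj[OF hb], of "p i" i]
        by (auto simp: fixing_off_pair_def moving_perms_def)
    qed
    have "{i \<in> M - {x', y'}. ?q i \<noteq> i} \<subseteq> h ` {i \<in> M - {x, y}. p i \<noteq> i}"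
    proof
      fix i assume i: "i \<in> {i \<in> M - {x', y'}. ?q i \<noteq> i}"
      have hi: "h (inv h i) = i" using hb by (simp add: bij_is_surj surj_f_inv_f)
      have "inv h i \<in> M" using i permutes_in_image[OF permutes_inv[OF h(1)]] by auto
      moreover have "inv h i \<noteq> x" "inv h i \<noteq> y" "p (inv h i) \<noteq> inv h i"
        using i hi h by auto
      ultimately show "i \<in> h ` {i \<in> M - {x, y}. p i \<noteq> i}"
        using hi by (intro image_eqI[of _ _ "inv h i"]) auto
    qed
    then have "card {i \<in> M - {x', y'}. ?q i \<noteq> i} \<le> card {i \<in> M - {x, y}. p i \<noteq> i}"
      using fin by (intro surj_card_le) auto
    then show "?q \<in> fixing_off_pair M K r x' y'"
      using p 1 2 by (auto simp: fixing_off_pair_def moving_perms_def)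
  qed
qed

section \<open>Double counting of agreements with \<open>g\<close>\<close>

text \<open>Count pairs \<open>(p, i)\<close> with \<open>p i = g i\<close>. Each \<open>p\<close>
  differs from \<open>g\<close> at no more than \<open>card M - u\<close> points of
  \<open>M\<close>, so it lies in at least \<open>u\<close> pairs; for each \<open>i\<close>, the
  switching bound for the pair \<open>i\<close>, \<open>g i\<close> limits the number of
  \<open>p\<close>.\<close>

lemma close_to_both_double_count:
  assumes fin: "finite M" "finite K" and dj: "M \<inter> K = {}"
    and g: "g permutes M" "\<And>i. i \<in> M \<Longrightarrow> g i \<noteq> i"
    and xy: "x \<in> M" "y \<in> M" "x \<noteq> y" and u: "card M + card K = r + u"
  shows "u * r * card (close_to_both M K r g) \<le> card M * card (fixing_off_pair M K r x y)"
proof -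
  let ?L = "close_to_both M K r g" and ?T = "fixing_off_pair M K r"
  have finL: "finite ?L" using finite_moving_perms[OF fin] by (auto simp: close_to_both_def)
  have finT: "finite (?T i j)" for i j
    using finite_moving_perms[OF fin] by (auto simp: fixing_off_pair_def)
  have gM: "g i \<in> M" if "i \<in> M" for i using that g(1) by (simp add: permutes_in_image)
  have "u * card ?L \<le> (\<Sum>p\<in>?L. card {i \<in> M. p i = g i})"
  proof -
    have "u \<le> card {i \<in> M. p i = g i}" if "p \<in> ?L" for p
    proof -
      have "card M = card {i \<in> M. p i = g i} + card {i \<in> M. p i \<noteq> g i}"
        using fin by (subst card_Un_disjoint[symmetric]) (auto intro: arg_cong[where f = card])
      then show ?thesis using that u by (auto simp: close_to_both_def)
    qed
    then show ?thesis
      using sum_bounded_below[of ?L u "\<lambda>p. card {i \<in> M. p i = g i}"] by (simp add: mult.commute)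
  qed
  also have "\<dots> = (\<Sum>i\<in>M. card {p \<in> ?L. p i = g i})"
    by (rule sum_multicount_gen[OF finL fin(1)]) auto
  also have "\<dots> \<le> (\<Sum>i\<in>M. card {p \<in> ?T i (g i). p i = g i})"
  proof (rule sum_mono, rule card_mono)
    fix i assume i: "i \<in> M"
    show "finite {p \<in> ?T i (g i). p i = g i}" using finT by auto
    show "{p \<in> ?L. p i = g i} \<subseteq> {p \<in> ?T i (g i). p i = g i}"
    proof clarify
      fix p assume p: "p \<in> ?L" "p i = g i"
      then have "inj p" by (auto simp: close_to_both_def moving_perms_def permutes_inj)
      \<comment> \<open>Injectivity forces \<open>p\<close> to move \<open>g i\<close> along with
        \<open>i\<close>; these two moved points match the summand 2 in the comparison
        block.\<close>
      then have "p (g i) \<noteq> g i" using p(2) g(2)[OF i] by (metis injD)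
      then have "{j \<in> M. p j \<noteq> j} = insert i (insert (g i) {j \<in> M - {i, g i}. p j \<noteq> j})"
        using i gM p(2) g(2) by auto
      then have "card {j \<in> M. p j \<noteq> j} = 2 + card {j \<in> M - {i, g i}. p j \<noteq> j}"
        using fin g(2)[OF i] by simp
      then show "p \<in> ?T i (g i)"
        using p by (auto simp: close_to_both_def fixing_off_pair_def)
    qed
  qed
  finally have "u * r * card ?L \<le> r * (\<Sum>i\<in>M. card {p \<in> ?T i (g i). p i = g i})"
    by (simp add: mult.assoc mult.left_commute)
  also have "\<dots> = (\<Sum>i\<in>M. r * card {p \<in> ?T i (g i). p i = g i})"
    by (rule sum_distrib_left)
  also have "\<dots> \<le> (\<Sum>i\<in>M. card (?T x y))"
  proof (rule sum_mono)
    fix i assume i: "i \<in> M"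
    have "r * card {p \<in> ?T i (g i). p i = g i} \<le> card (?T i (g i))"
      using i gM[OF i] g(2)[OF i] u by (intro fixing_off_pair_switch[OF fin dj]) auto
    also have "\<dots> \<le> card (?T x y)"
      using i gM[OF i] g(2)[OF i] xy by (intro card_fixing_off_pair_le[OF fin dj]) auto
    finally show "r * card {p \<in> ?T i (g i). p i = g i} \<le> card (?T x y)" .
  qed
  finally show ?thesis by simp
qed

section \<open>Derangements that agree with \<open>g\<close> somewhere\<close>

definition derangements :: "'a set \<Rightarrow> ('a \<Rightarrow> 'a) set" where
  "derangements M = {p. p permutes M \<and> (\<forall>i\<in>M. p i \<noteq> i)}"

lemma finite_derangements: "finite M \<Longrightarrow> finite (derangements M)"
  unfolding derangements_def
  by (rule finite_subset[OF _ finite_permutations[of M]]) auto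

lemma card_derangements_arc_le:
  assumes "finite M" and xy: "x \<in> M" "y \<in> M" "x \<noteq> y" "x' \<in> M" "y' \<in> M" "x' \<noteq> y'"
  shows "card {p \<in> derangements M. p x = y} \<le> card {p \<in> derangements M. p x' = y'}"
proof -
  obtain h where h: "h permutes M" "h x = x'" "h y = y'"
    using permutes_moving_pair[OF xy] .
  have hb: "bij h" using h by (simp add: permutes_bij)
  show ?thesis
  proof (rule card_conjugate_le[OF hb])
    show "finite {p \<in> derangements M. p x' = y'}"
      using finite_derangements[OF assms(1)] by simp
    fix p assume p: "p \<in> {p \<in> derangements M. p x = y}"
    let ?q = "h \<circ> p \<circ> inv h"
    have 1: "?q permutes M"
      using p h by (auto simp: derangements_def intro!: permutes_compose permutes_inv)
    have 2: "?q i \<noteq> i" if "i \<in> M" for i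
    proof -
      have hi: "h (inv h i) = i" using hb by (simp add: bij_is_surj surj_f_inv_f)
      have "inv h i \<in> M" using that permutes_in_image[OF permutes_inv[OF h(1)]] by auto
      then have "p (inv h i) \<noteq> inv h i" using p by (auto simp: derangements_def)
      then show ?thesis using injD[OF bij_is_inj[OF hb], of "p (inv h i)" "inv h i"] hi by auto
    qed
    have "inv h x' = x" using h hb by (metis bij_is_inj inv_f_f)
    then show "?q \<in> {p \<in> derangements M. p x' = y'}"
      using 1 2 p h by (auto simp: derangements_def)
  qed
qed

text \<open>Switch at \<open>j\<close> with a point \<open>w\<close>. Excluding \<open>i\<close>
  keeps the arc from \<open>i\<close> to \<open>c\<close>; excluding \<open>e\<close> and the
  preimage of \<open>j\<close> prevents \<open>w\<close> and \<open>j\<close> from becoming fixed.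
  At least \<open>6 - 3 = 3\<close> choices remain.\<close>

lemma card_derangements_two_arcs:
  assumes fin: "finite M" "card M \<ge> 6" and ij: "i \<in> M" "j \<in> M" "i \<noteq> j" "e \<in> M"
  shows "3 * card {p \<in> derangements M. p i = c \<and> p j = e} \<le> card {p \<in> derangements M. p i = c}"
proof (rule switch_card[where x = j and y = e and W = "\<lambda>p. M - {i, e, inv p j}"])
  fix p assume p: "p \<in> {p \<in> derangements M. p i = c \<and> p j = e}"
  then have perm: "p permutes M" and pM: "\<And>i. i \<in> M \<Longrightarrow> p i \<noteq> i" by (auto simp: derangements_def)
  show "inj p \<and> p j = e" using p perm by (auto intro: permutes_inj)
  have "card M - card {i, e, inv p j} \<le> card (M - {i, e, inv p j})"
    by (rule diff_card_le_card_Diff) simp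
  moreover have "card {i, e, inv p j} \<le> 3"
    by (simp add: card_insert_if)
  ultimately show "finite (M - {i, e, inv p j}) \<and> 3 \<le> card (M - {i, e, inv p j})"
    using fin by auto
  fix w assume w: "w \<in> M - {i, e, inv p j}"
  have "p w \<noteq> j" using w perm by (metis DiffE insertCI permutes_inverses(2))
  moreover have "p \<circ> transpose j w permutes M"
    using w ij by (intro permutes_compose[OF permutes_swap_id perm]) auto
  ultimately show "p \<circ> transpose j w \<in> {p \<in> derangements M. p i = c}"
    using p w pM ij by (auto simp: derangements_def transpose_def)
qed (use finite_derangements[OF fin(1)] in auto)

lemma card_three_sets_ge:
  assumes "finite A" "finite B" "finite C"
  shows "card A + card B + card C \<le> card (A \<union> B \<union> C) + card (A \<inter> B) + card (A \<inter> C) + card (B \<inter> C)"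
proof -
  have "card A + card B = card (A \<union> B) + card (A \<inter> B)"
    using assms(1,2) by (rule card_Un_Int)
  moreover have "card (A \<union> B) + card C = card (A \<union> B \<union> C) + card ((A \<union> B) \<inter> C)"
    using assms by (intro card_Un_Int) auto
  moreover have "card ((A \<union> B) \<inter> C) \<le> card (A \<inter> C) + card (B \<inter> C)"
    by (metis Int_Un_distrib2 card_Un_le)
  ultimately show ?thesis by linarith
qed

text \<open>By symmetry each arc lies in the same number of derangements. The factor 2 pays for the
  permutations that fix \<open>x\<close> and for those that fix \<open>y\<close> in the comparison
  of complements below.\<close>

lemma card_derangements_meeting:
  assumes fin: "finite M" "card M \<ge> 6" and g: "g permutes M" "\<And>i. i \<in> M \<Longrightarrow> g i \<noteq> i"
    and xy: "x \<in> M" "y \<in> M" "x \<noteq> y"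
  shows "2 * card {p \<in> derangements M. p x = y} \<le> card {p \<in> derangements M. \<exists>i\<in>M. p i = g i}"
proof -
  define d where "d = card {p \<in> derangements M. p x = y}"
  define E where "E i = {p \<in> derangements M. p i = g i}" for i
  have gM: "g i \<in> M" if "i \<in> M" for i using that g(1) by (simp add: permutes_in_image)
  obtain N where N: "N \<subseteq> M" "card N = 3"
    using obtain_subset_with_card_n[of 3 M] fin by auto
  then obtain i j k where "N = {i, j, k}" and ne: "i \<noteq> j" "i \<noteq> k" "j \<noteq> k"
    by (metis card_3_iff)
  then have ijk: "i \<in> M" "j \<in> M" "k \<in> M" "i \<noteq> j" "i \<noteq> k" "j \<noteq> k"
    using N(1) ne by simp_all
  have finD: "finite (derangements M)" using fin by (simp add: finite_derangements)
  have finE: "finite (E i)" for i using finD by (simp add: E_def)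
  have cE: "card (E i) = d" if "i \<in> M" for i
  proof -
    note i = that gM[OF that] g(2)[OF that, symmetric]
    show ?thesis
      unfolding E_def d_def
      using card_derangements_arc_le[OF fin(1) i xy] card_derangements_arc_le[OF fin(1) xy i]
      by (rule le_antisym)
  qed
  have cEE: "3 * card (E i \<inter> E j) \<le> d" if "i \<in> M" "j \<in> M" "i \<noteq> j" for i j
  proof -
    have "E i \<inter> E j = {p \<in> derangements M. p i = g i \<and> p j = g j}" by (auto simp: E_def)
    then have "3 * card (E i \<inter> E j) \<le> card (E i)"
      unfolding E_def using card_derangements_two_arcs[OF fin that gM[OF that(2)], of "g i"] by simp
    then show ?thesis using cE that by simp
  qed
  \<comment> \<open>Bonferroni: three sets of size \<open>d\<close> whose pairwise intersections have size at most \<open>d / 3\<close>.\<close>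
  have "3 * d \<le> card (E i \<union> E j \<union> E k) + card (E i \<inter> E j) + card (E i \<inter> E k) + card (E j \<inter> E k)"
    using card_three_sets_ge[OF finE finE finE, of i j k] cE ijk by simp
  moreover have "card (E i \<union> E j \<union> E k) \<le> card {p \<in> derangements M. \<exists>i\<in>M. p i = g i}"
    using finD ijk by (intro card_mono) (auto simp: E_def)
  ultimately show ?thesis
    using cEE[OF ijk(1,2,4)] cEE[OF ijk(1,3,5)] cEE[OF ijk(2,3,6)] unfolding d_def by linarith
qed

text \<open>Swapping the values \<open>x\<close> and \<open>y\<close> turns the fixed point
  \<open>x\<close> into an arc from \<open>x\<close> to \<open>y\<close> and also removes a possible
  fixed point at \<open>y\<close>.\<close>

lemma card_fixing_arc_le:
  assumes fin: "finite M" and xy: "x \<in> M" "y \<in> M" "x \<noteq> y"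
  shows "card {q. q permutes M \<and> (\<forall>i\<in>M - {x, y}. q i \<noteq> i) \<and> q x = x}
          \<le> card {p \<in> derangements M. p x = y}" (is "card ?A \<le> card ?B")
proof (rule card_inj_on_le[where f = "\<lambda>q. transpose x y \<circ> q"])
  show "inj_on (\<lambda>q. transpose x y \<circ> q) ?A"
    by (rule inj_onI) (metis comp_assoc transpose_comp_involutory id_comp)
  show "finite ?B" using fin by (simp add: finite_derangements)
  show "(\<lambda>q. transpose x y \<circ> q) ` ?A \<subseteq> ?B"
  proof (clarify, intro conjI)
    fix q assume q: "q permutes M" "\<forall>i\<in>M - {x, y}. q i \<noteq> i" "q x = x"
    have 1: "(transpose x y \<circ> q) permutes M"
      using q xy by (intro permutes_compose permutes_swap_id) auto
    \<comment> \<open>This excludes \<open>q y = x\<close>, the one situation in which the swap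
      would make \<open>y\<close> fixed.\<close>
    have "\<forall>i. q i = x \<longrightarrow> i = x"
      using q by (metis permutes_inj injD)
    then have "(transpose x y \<circ> q) i \<noteq> i" if "i \<in> M" for i
      using that q xy by (auto simp: transpose_def)
    then show "transpose x y \<circ> q \<in> derangements M" using 1 by (auto simp: derangements_def)
    show "(transpose x y \<circ> q) x = y" using q by simp
  qed
qed

text \<open>Compare complements. On the left it is \<open>?D \<union> D'\<close>; on the right it
  consists of the derangements and of the permutations without fixed points off the pair that fix
  \<open>x\<close> or \<open>y\<close>. The latter are fewer than or as many as the derangements
  outside \<open>D'\<close>.\<close>

lemma card_both_agree_le:
  assumes fin: "finite M" "card M \<ge> 6" and g: "g permutes M" "\<And>i. i \<in> M \<Longrightarrow> g i \<noteq> i"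
    and xy: "x \<in> M" "y \<in> M" "x \<noteq> y"
  shows "card {p. p permutes M \<and> (\<exists>i\<in>M. p i = i) \<and> (\<exists>i\<in>M. p i = g i)}
          \<le> card {p. p permutes M \<and> (\<exists>i\<in>M - {x, y}. p i = i)}" (is "card ?L \<le> card ?R")
proof -
  let ?P = "{p. p permutes M}" and ?D = "derangements M"
  define D' where "D' = {p. p permutes M \<and> (\<forall>i\<in>M. p i \<noteq> g i)}"
  define Y where "Y = (\<lambda>a b. {q. q permutes M \<and> (\<forall>i\<in>M - {a, b}. q i \<noteq> i) \<and> q a = a})"
  let ?E = "{p \<in> ?D. \<exists>i\<in>M. p i = g i}"
  have finP: "finite ?P" using fin by (simp add: finite_permutations)
  have sub: "?D \<subseteq> ?P" "D' \<subseteq> ?P" "Y x y \<subseteq> ?P" "Y y x \<subseteq> ?P"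
    by (auto simp: derangements_def D'_def Y_def)
  note finS = sub[THEN finite_subset, OF finP]
  \<comment> \<open>Composing with \<open>g\<close> turns having no fixed point into agreeing
    nowhere with \<open>g\<close>.\<close>
  have "card ?D \<le> card D'"
  proof (rule card_inj_on_le[where f = "\<lambda>p. g \<circ> p"])
    show "inj_on (\<lambda>p. g \<circ> p) ?D"
      using permutes_inj[OF g(1)] by (auto intro!: inj_onI simp: fun_eq_iff inj_eq)
    show "(\<lambda>p. g \<circ> p) ` ?D \<subseteq> D'"
      using g(1) permutes_inj[OF g(1)]
      by (auto simp: derangements_def D'_def inj_eq intro: permutes_compose)
  qed (rule finS)
  moreover have "card (?D \<union> D') = card D' + card ?E"
  proof -
    have "?D \<union> D' = D' \<union> ?E" "D' \<inter> ?E = {}" by (auto simp: derangements_def D'_def)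
    then show ?thesis using finS by (simp add: card_Un_disjoint)
  qed
  ultimately have 1: "card ?D + card ?E \<le> card (?D \<union> D')" by simp
  have "card (Y x y) \<le> card {p \<in> ?D. p x = y}"
    unfolding Y_def by (rule card_fixing_arc_le[OF fin(1) xy])
  moreover have "card (Y y x) \<le> card {p \<in> ?D. p x = y}"
    unfolding Y_def using card_fixing_arc_le[OF fin(1) xy(2,1)] xy
      card_derangements_arc_le[OF fin(1) xy(2,1) _ xy] by force
  moreover have "2 * card {p \<in> ?D. p x = y} \<le> card ?E"
    by (rule card_derangements_meeting[OF fin g xy])
  ultimately have 2: "card (Y x y) + card (Y y x) \<le> card ?E" by linarith
  have "card (?D \<union> (Y x y \<union> Y y x)) \<le> card ?D + (card (Y x y) + card (Y y x))"
    by (meson card_Un_le add_left_mono order_trans)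
  also have "\<dots> \<le> card (?D \<union> D')" using 1 2 by linarith
  finally have 3: "card (?D \<union> (Y x y \<union> Y y x)) \<le> card (?D \<union> D')" .
  have L: "?L = ?P - (?D \<union> D')" by (auto simp: derangements_def D'_def)
  have R: "?R = ?P - (?D \<union> (Y x y \<union> Y y x))"
    using xy by (auto simp: derangements_def Y_def)
  show ?thesis
    unfolding L R using 3 finP finS sub by (simp add: card_Diff_subset)
qed

section \<open>Comparison block by block\<close>

lemma card_close_to_both_le:
  assumes fin: "finite M" "finite K" and dj: "M \<inter> K = {}" and r: "r \<ge> 5"
    and g: "g permutes M" "\<And>i. i \<in> M \<Longrightarrow> g i \<noteq> i"
    and xy: "x \<in> M" "y \<in> M" "x \<noteq> y"
  shows "card (close_to_both M K r g) \<le> card (fixing_off_pair M K r x y)"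
proof -
  have finT: "finite (fixing_off_pair M K r x y)"
    using finite_moving_perms[OF fin] by (auto simp: fixing_off_pair_def)
  have "card {x, y} \<le> card M" using xy fin by (intro card_mono) auto
  then have s2: "card (M - {x, y}) + 2 = card M"
    using xy card_Diff_subset[of "{x, y}" M] by simp
  consider "card M + card K \<le> r" | u where "u > 0" "card M + card K = r + u"
    using less_imp_add_positive[of r "card M + card K"] by (metis not_le)
  then show ?thesis
  proof cases
    case 1
    have "card {i \<in> M - {x, y}. p i \<noteq> i} \<le> card (M - {x, y})" for p
      using fin by (intro card_mono) auto
    from add_left_mono[OF this, of "card K + 2"]
    have "card K + 2 + card {i \<in> M - {x, y}. p i \<noteq> i} \<le> r" for p
      by (rule order_trans) (use 1 s2 in linarith)
    then show ?thesis
      by (intro card_mono[OF finT]) (auto simp: close_to_both_def fixing_off_pair_def)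
  next
    case (2 u)
    have count: "u * r * card (close_to_both M K r g) \<le> card M * card (fixing_off_pair M K r x y)"
      by (rule close_to_both_double_count[OF fin dj g xy 2(2)])
    show ?thesis
    proof (cases "card M \<le> u * r")
      case True
      then have "u * r * card (close_to_both M K r g) \<le> u * r * card (fixing_off_pair M K r x y)"
        using count by (meson mult_le_mono1 order_trans)
      then show ?thesis using 2 r by simp
    next
      case False
      \<comment> \<open>For \<open>u \<ge> 2\<close> one has
        \<open>card M \<le> r + u \<le> u * r\<close>, contrary to the case assumption.\<close>
      have "u = 1"
      proof (rule ccontr)
        assume "u \<noteq> 1"
        then obtain v where "u = 2 + v" using 2(1) le_Suc_ex[of 2 u] by auto
        moreover have "v \<le> v * r" using r by simp
        moreover have "u * r = r + r + v * r" unfolding \<open>u = 2 + v\<close> by (simp add: algebra_simps)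
        ultimately have "r + u \<le> u * r" using r by linarith
        then show False using False 2(2) by simp
      qed
      \<comment> \<open>Now \<open>r < card M\<close> while \<open>card M + card K = r + 1\<close>,
        which leaves no room for \<open>K\<close>.\<close>
      then have "card K = 0" "card M = Suc r" using False 2(2) by simp_all
      then have K: "K = {}" and M: "card M = Suc r" using fin by auto
      have moved: "card {i \<in> M. p i \<noteq> f i} \<le> r \<longleftrightarrow> (\<exists>i\<in>M. p i = f i)" for p f :: "'a \<Rightarrow> 'a"
      proof
        assume "card {i \<in> M. p i \<noteq> f i} \<le> r"
        then have "{i \<in> M. p i \<noteq> f i} \<noteq> M" using M by auto
        then show "\<exists>i\<in>M. p i = f i" by auto
      next
        assume "\<exists>i\<in>M. p i = f i"
        then have "card {i \<in> M. p i \<noteq> f i} < card M" using fin by (intro psubset_card_mono) auto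
        then show "card {i \<in> M. p i \<noteq> f i} \<le> r" using M by simp
      qed
      \<comment> \<open>Here \<open>M - {x, y}\<close> has \<open>r - 1\<close> points, so moving at
        most \<open>r - 2\<close> of them means fixing one.\<close>
      have moved': "2 + card {i \<in> M - {x, y}. p i \<noteq> i} \<le> r \<longleftrightarrow> (\<exists>i\<in>M - {x, y}. p i = i)"
        for p :: "'a \<Rightarrow> 'a"
      proof
        assume le: "2 + card {i \<in> M - {x, y}. p i \<noteq> i} \<le> r"
        have "{i \<in> M - {x, y}. p i \<noteq> i} \<noteq> M - {x, y}"
        proof
          assume "{i \<in> M - {x, y}. p i \<noteq> i} = M - {x, y}"
          with le have "2 + card (M - {x, y}) \<le> r" by (simp only:)
          then show False using M s2 by linarith
        qed
        then show "\<exists>i\<in>M - {x, y}. p i = i" by auto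
      next
        assume "\<exists>i\<in>M - {x, y}. p i = i"
        then have "card {i \<in> M - {x, y}. p i \<noteq> i} < card (M - {x, y})"
          using fin by (intro psubset_card_mono) auto
        then show "2 + card {i \<in> M - {x, y}. p i \<noteq> i} \<le> r" using M s2 by linarith
      qed
      have "close_to_both M K r g = {p. p permutes M \<and> (\<exists>i\<in>M. p i = i) \<and> (\<exists>i\<in>M. p i = g i)}"
        by (simp add: close_to_both_def moving_perms_def K moved[of _ "\<lambda>i. i"] moved)
      moreover have "fixing_off_pair M K r x y = {p. p permutes M \<and> (\<exists>i\<in>M - {x, y}. p i = i)}"
        unfolding fixing_off_pair_def K card.empty add_0 moved' by (simp add: moving_perms_def)
      \<comment> \<open>The hypothesis \<open>r \<ge> 5\<close> supplies
        \<open>card M \<ge> 6\<close>.\<close>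
      ultimately show ?thesis
        using card_both_agree_le[OF fin(1) _ g xy] M r by simp
    qed
  qed
qed

section \<open>Summing over the blocks\<close>

definition common_ball :: "'a set \<Rightarrow> nat \<Rightarrow> ('a \<Rightarrow> 'a) \<Rightarrow> ('a \<Rightarrow> 'a) set" where
  "common_ball S r g =
     {p. p permutes S \<and> card {i \<in> S. p i \<noteq> i} \<le> r \<and> card {i \<in> S. p i \<noteq> g i} \<le> r}"

definition off_pair_ball :: "'a set \<Rightarrow> nat \<Rightarrow> 'a \<Rightarrow> 'a \<Rightarrow> ('a \<Rightarrow> 'a) set" where
  "off_pair_ball S r x y = {p. p permutes S \<and> 2 + card {i \<in> S - {x, y}. p i \<noteq> i} \<le> r}"

lemma card_eq_sum_moved_outside:
  assumes "finite S" "A \<subseteq> {p. p permutes S}"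
  shows "card A = (\<Sum>K\<in>Pow (S - M). card {p \<in> A. {i \<in> S - M. p i \<noteq> i} = K})"
proof -
  have "finite A" using assms finite_permutations finite_subset by blast
  moreover have "(\<lambda>p. {i \<in> S - M. p i \<noteq> i}) ` A \<subseteq> Pow (S - M)" by blast
  ultimately show ?thesis
    using sum.group[of A "Pow (S - M)" "\<lambda>p. {i \<in> S - M. p i \<noteq> i}" "\<lambda>_. 1 :: nat"] assms(1)
    by simp
qed

lemma permutes_moved_outside_iff:
  assumes "M \<subseteq> S" "K \<subseteq> S - M"
  shows "p permutes S \<and> {i \<in> S - M. p i \<noteq> i} = K \<longleftrightarrow> p \<in> moving_perms M K"
proof
  assume p: "p permutes S \<and> {i \<in> S - M. p i \<noteq> i} = K"
  have "p permutes (M \<union> K)"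
    by (rule permutes_superset[of p S]) (use p in auto)
  then show "p \<in> moving_perms M K" using p by (auto simp: moving_perms_def)
next
  assume p: "p \<in> moving_perms M K"
  then have perm: "p permutes (M \<union> K)" by (simp add: moving_perms_def)
  have "p permutes S" by (rule permutes_subset[OF perm]) (use assms in auto)
  moreover have "p i = i" if "i \<notin> M \<union> K" for i
    using perm that by (rule permutes_not_in)
  then have "{i \<in> S - M. p i \<noteq> i} = K"
    using p assms(2) by (auto simp: moving_perms_def)
  ultimately show "p permutes S \<and> {i \<in> S - M. p i \<noteq> i} = K" ..
qed

lemma card_differing_split:
  assumes "finite S" "M \<subseteq> S" "\<And>i. i \<in> S - M \<Longrightarrow> f i = i"
  shows "card {i \<in> S. p i \<noteq> f i} = card {i \<in> S - M. p i \<noteq> i} + card {i \<in> M. p i \<noteq> f i}"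
proof -
  have "{i \<in> S. p i \<noteq> f i} = {i \<in> S - M. p i \<noteq> i} \<union> {i \<in> M. p i \<noteq> f i}"
    using assms by auto
  moreover have "finite {i \<in> M. p i \<noteq> f i}"
    using finite_subset[OF assms(2,1)] by simp
  moreover have "{i \<in> S - M. p i \<noteq> i} \<inter> {i \<in> M. p i \<noteq> f i} = {}" by blast
  ultimately show ?thesis using assms(1) by (simp add: card_Un_disjoint)
qed

text \<open>Since \<open>g\<close> is the identity off \<open>M\<close>, the set \<open>K\<close> of
  points moved there contributes \<open>card K\<close> to both distances, and the blocks are exactly
  the classes of this partition.\<close>

lemma card_common_ball:
  assumes "finite S" "M \<subseteq> S" "g permutes M"
  shows "card (common_ball S r g) = (\<Sum>K\<in>Pow (S - M). card (close_to_both M K r g))"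
proof -
  have "{p \<in> common_ball S r g. {i \<in> S - M. p i \<noteq> i} = K} = close_to_both M K r g"
    if "K \<in> Pow (S - M)" for K
  proof -
    have K: "K \<subseteq> S - M" using that by simp
    have g: "g i = i" if "i \<in> S - M" for i
      using that permutes_not_in[OF assms(3)] by simp
    have "card {i \<in> S. p i \<noteq> g i} = card {i \<in> S - M. p i \<noteq> i} + card {i \<in> M. p i \<noteq> g i}"
      and "card {i \<in> S. p i \<noteq> i} = card {i \<in> S - M. p i \<noteq> i} + card {i \<in> M. p i \<noteq> i}" for p
      using card_differing_split[OF assms(1,2), of g] card_differing_split[OF assms(1,2), of "\<lambda>i. i"] g
      by simp_all
    note split = this
    show ?thesis
    proof (rule set_eqI)
      fix p
      have "p \<in> {p \<in> common_ball S r g. {i \<in> S - M. p i \<noteq> i} = K} \<longleftrightarrow>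
          (p permutes S \<and> {i \<in> S - M. p i \<noteq> i} = K) \<and> card K + card {i \<in> M. p i \<noteq> i} \<le> r
            \<and> card K + card {i \<in> M. p i \<noteq> g i} \<le> r"
        unfolding common_ball_def mem_Collect_eq split by blast
      then show "p \<in> {p \<in> common_ball S r g. {i \<in> S - M. p i \<noteq> i} = K} \<longleftrightarrow> p \<in> close_to_both M K r g"
        unfolding permutes_moved_outside_iff[OF assms(2) K] close_to_both_def by simp
    qed
  qed
  then show ?thesis
    by (subst card_eq_sum_moved_outside[OF assms(1), of _ M])
      (auto simp: common_ball_def intro!: sum.cong)
qed

lemma card_off_pair_ball:
  assumes "finite S" "M \<subseteq> S" "x \<in> M" "y \<in> M"
  shows "card (off_pair_ball S r x y) = (\<Sum>K\<in>Pow (S - M). card (fixing_off_pair M K r x y))"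
proof -
  have split: "card {i \<in> S - {x, y}. p i \<noteq> i}
      = card {i \<in> S - M. p i \<noteq> i} + card {i \<in> M - {x, y}. p i \<noteq> i}" for p
  proof -
    have "S - {x, y} - (M - {x, y}) = S - M" using assms by auto
    then show ?thesis
      using card_differing_split[of "S - {x, y}" "M - {x, y}" "\<lambda>i. i" p] assms by auto
  qed
  have "{p \<in> off_pair_ball S r x y. {i \<in> S - M. p i \<noteq> i} = K} = fixing_off_pair M K r x y"
    if "K \<in> Pow (S - M)" for K
  proof -
    have K: "K \<subseteq> S - M" using that by simp
    show ?thesis
    proof (rule set_eqI)
      fix p
      have "p \<in> {p \<in> off_pair_ball S r x y. {i \<in> S - M. p i \<noteq> i} = K} \<longleftrightarrow>
          (p permutes S \<and> {i \<in> S - M. p i \<noteq> i} = K)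
            \<and> 2 + (card K + card {i \<in> M - {x, y}. p i \<noteq> i}) \<le> r"
        unfolding off_pair_ball_def mem_Collect_eq split by blast
      then show "p \<in> {p \<in> off_pair_ball S r x y. {i \<in> S - M. p i \<noteq> i} = K}
          \<longleftrightarrow> p \<in> fixing_off_pair M K r x y"
        unfolding permutes_moved_outside_iff[OF assms(2) K] fixing_off_pair_def by simp
    qed
  qed
  then show ?thesis
    by (subst card_eq_sum_moved_outside[OF assms(1), of _ M])
      (auto simp: off_pair_ball_def intro!: sum.cong)
qed

text \<open>Take \<open>M = {x, y}\<close>: nothing of \<open>M\<close> remains off the pair, so a
  block is either empty or all of \<open>moving_perms {x, y} K\<close>, depending only on
  \<open>card K\<close>. Grouping the sets \<open>K\<close> by size gives the binomial
  coefficients.\<close>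

lemma card_off_pair_ball_eq_sum:
  assumes fin: "finite S" and xy: "x \<in> S" "y \<in> S" "x \<noteq> y" and r: "r \<ge> 2"
  shows "card (off_pair_ball S r x y) =
           (\<Sum>k\<le>r - 2. ((card S - 2) choose k) * partial_derangements (k + 2) k)"
proof -
  let ?F = "S - {x, y}" and ?h = "\<lambda>k. partial_derangements (k + 2) k"
  have finF: "finite ?F" and cF: "card ?F = card S - 2"
    using fin xy card_Diff_subset[of "{x, y}" S] by simp_all
  have block: "card (fixing_off_pair {x, y} K r x y) = (if card K \<le> r - 2 then ?h (card K) else 0)"
    if "K \<in> Pow ?F" for K
  proof -
    have "finite K" using that finF finite_subset by blast
    then have "card (moving_perms {x, y} K) = ?h (card K)"
      using card_moving_perms[of "{x, y}" K] that xy by (auto simp: add.commute)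
    moreover have "fixing_off_pair {x, y} K r x y = (if card K \<le> r - 2 then moving_perms {x, y} K else {})"
      using r by (auto simp: fixing_off_pair_def)
    ultimately show ?thesis by simp
  qed
  have "card (off_pair_ball S r x y) = (\<Sum>K\<in>Pow ?F. if card K \<le> r - 2 then ?h (card K) else 0)"
    using card_off_pair_ball[OF fin, of "{x, y}" x y] block xy by simp
  also have "\<dots> = (\<Sum>K\<in>{K \<in> Pow ?F. card K \<le> r - 2}. ?h (card K))"
    using finF by (intro sum.inter_filter[symmetric]) simp
  also have "\<dots> = (\<Sum>k\<le>r - 2. \<Sum>K\<in>{K \<in> {K \<in> Pow ?F. card K \<le> r - 2}. card K = k}. ?h (card K))"
    using finF by (intro sum.group[symmetric]) auto
  also have "\<dots> = (\<Sum>k\<le>r - 2. (card ?F choose k) * ?h k)"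
  proof (rule sum.cong[OF refl])
    fix k assume "k \<in> {..r - 2}"
    then have "{K \<in> {K \<in> Pow ?F. card K \<le> r - 2}. card K = k} = {K. K \<subseteq> ?F \<and> card K = k}"
      by auto
    then show "(\<Sum>K\<in>{K \<in> {K \<in> Pow ?F. card K \<le> r - 2}. card K = k}. ?h (card K))
        = (card ?F choose k) * ?h k"
      using n_subsets[OF finF, of k] by simp
  qed
  finally show ?thesis unfolding cF .
qed

section \<open>Transpositions are extremal\<close>

lemma close_to_both_transpose:
  assumes xy: "x \<noteq> y"
  shows "close_to_both {x, y} K r (transpose x y) = fixing_off_pair {x, y} K r x y"
proof -
  have "(card K + card {i \<in> {x, y}. p i \<noteq> i} \<le> r
        \<and> card K + card {i \<in> {x, y}. p i \<noteq> transpose x y i} \<le> r) \<longleftrightarrow> card K + 2 \<le> r"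
    if "p \<in> moving_perms {x, y} K" for p
  proof -
    let ?A = "{i \<in> {x, y}. p i \<noteq> i}" and ?B = "{i \<in> {x, y}. p i \<noteq> transpose x y i}"
    have "inj p" using that by (auto simp: moving_perms_def permutes_inj)
    then have "p x \<noteq> p y" using xy by (auto dest: injD)
    \<comment> \<open>Agreeing with the identity at one point of the pair and with the swap at the
      other would give both points the same image. So the larger of the two distances is always
      \<open>card K + 2\<close>.\<close>
    then have "?A = {x, y} \<or> ?B = {x, y}" by auto
    then have "card ?A = 2 \<or> card ?B = 2" using xy by fastforce
    moreover have "card ?A \<le> card {x, y}" "card ?B \<le> card {x, y}"
      by (intro card_mono; auto)+
    ultimately show ?thesis using xy by auto
  qed
  then show ?thesis by (auto simp: close_to_both_def fixing_off_pair_def)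
qed

lemma card_common_ball_transpose:
  assumes "finite S" "x \<in> S" "y \<in> S" "x \<noteq> y"
  shows "card (common_ball S r (transpose x y)) = card (off_pair_ball S r x y)"
proof -
  have "transpose x y permutes {x, y}" by (rule permutes_swap_id) auto
  then show ?thesis
    using card_common_ball[OF assms(1), of "{x, y}" "transpose x y" r]
      card_off_pair_ball[OF assms(1), of "{x, y}" x y r] assms
    by (simp add: close_to_both_transpose)
qed

lemma card_common_ball_le:
  assumes fin: "finite S" and g: "g permutes S" "\<exists>i\<in>S. g i \<noteq> i" and r: "r \<ge> 5"
  shows "card (common_ball S r g) \<le>
           (\<Sum>k\<le>r - 2. ((card S - 2) choose k) * partial_derangements (k + 2) k)"
proof -
  define M where "M = {i \<in> S. g i \<noteq> i}"
  have M: "M \<subseteq> S" by (auto simp: M_def)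
  have gM: "g permutes M" by (rule permutes_superset[OF g(1)]) (auto simp: M_def)
  obtain x where x: "x \<in> M" using g(2) by (auto simp: M_def)
  \<comment> \<open>Any second point of the support would serve; \<open>g x\<close> is one because
    \<open>g\<close> moves \<open>x\<close> within \<open>M\<close>.\<close>
  define y where "y = g x"
  have xy: "x \<in> M" "y \<in> M" "x \<noteq> y"
    using x permutes_in_image[OF gM, of x] by (auto simp: y_def M_def)
  have "card (common_ball S r g) = (\<Sum>K\<in>Pow (S - M). card (close_to_both M K r g))"
    by (rule card_common_ball[OF fin M gM])
  also have "\<dots> \<le> (\<Sum>K\<in>Pow (S - M). card (fixing_off_pair M K r x y))"
  proof (rule sum_mono)
    fix K assume "K \<in> Pow (S - M)"
    then show "card (close_to_both M K r g) \<le> card (fixing_off_pair M K r x y)"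
      using fin M finite_subset r gM xy
      by (intro card_close_to_both_le) (auto simp: M_def intro: finite_subset)
  qed
  also have "\<dots> = card (off_pair_ball S r x y)"
    by (rule card_off_pair_ball[OF fin M xy(1,2), symmetric])
  also have "\<dots> = (\<Sum>k\<le>r - 2. ((card S - 2) choose k) * partial_derangements (k + 2) k)"
    using xy M r by (intro card_off_pair_ball_eq_sum[OF fin]) auto
  finally show ?thesis .
qed

section \<open>Hamming balls and the maximum\<close>

lemma hamming_dist_eq:
  assumes "p permutes {1..n}"
  shows "hamming_dist n s p = card {i \<in> {1..n}. s i \<noteq> p i}"
proof -
  have "(perm_mult s (inv p)) i = i \<longleftrightarrow> s i = p i" for i
    using permutes_inv_eq[OF assms, of "s i" i] by (auto simp: perm_mult_def)
  then show ?thesis by (simp add: hamming_dist_def moved_def)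
qed

lemma hamming_ball_eq:
  "hamming_ball n r s = {q. q permutes {1..n} \<and> card {i \<in> {1..n}. s i \<noteq> q i} \<le> r}"
  by (simp add: hamming_ball_def sym_group_def hamming_dist_eq cong: conj_cong)

text \<open>Composing with \<open>inv p\<close> preserves the number of disagreements and moves the
  centre \<open>p\<close> to the identity.\<close>

lemma card_hamming_ball_inter_le:
  assumes p: "p permutes {1..n}"
  shows "card (hamming_ball n r p \<inter> hamming_ball n r t) \<le> card (common_ball {1..n} r (inv p \<circ> t))"
proof (rule card_inj_on_le[where f = "\<lambda>q. inv p \<circ> q"])
  have injp: "inj (inv p)" using permutes_inv[OF p] by (rule permutes_inj)
  then show "inj_on (\<lambda>q. inv p \<circ> q) (hamming_ball n r p \<inter> hamming_ball n r t)"
    by (auto intro!: inj_onI simp: fun_eq_iff inj_eq)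
  show "finite (common_ball {1..n} r (inv p \<circ> t))"
    unfolding common_ball_def by (rule finite_subset[OF _ finite_permutations[of "{1..n}"]]) auto
  have "inv p (q i) \<noteq> i \<longleftrightarrow> p i \<noteq> q i" for q i
    using permutes_inv_eq[OF p] by auto
  moreover have "inv p (q i) \<noteq> inv p (t i) \<longleftrightarrow> t i \<noteq> q i" for q i
    using injp by (auto simp: inj_eq)
  ultimately show "(\<lambda>q. inv p \<circ> q) ` (hamming_ball n r p \<inter> hamming_ball n r t)
      \<subseteq> common_ball {1..n} r (inv p \<circ> t)"
    using permutes_compose[OF _ permutes_inv[OF p]]
    by (auto simp: hamming_ball_eq common_ball_def)
qed

lemma max_ball_inter_eq_sum:
  assumes n: "n \<ge> 2" and r: "r \<ge> 5"
  shows "max_ball_inter n r = (\<Sum>k\<le>r - 2. ((n - 2) choose k) * partial_derangements (k + 2) k)"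
    (is "_ = ?N")
  unfolding max_ball_inter_def
proof (rule Max_eqI)
  let ?S = "sym_group n"
  have "finite ?S" by (simp add: sym_group_def finite_permutations)
  then have "finite ((\<lambda>(p, t). card (hamming_ball n r p \<inter> hamming_ball n r t)) ` (?S \<times> ?S))"
    by blast
  then show "finite {card (hamming_ball n r p \<inter> hamming_ball n r t) | p t.
            p \<in> ?S \<and> t \<in> ?S \<and> hamming_dist n p t \<ge> 2}"
    by (rule rev_finite_subset) auto
next
  fix c assume "c \<in> {card (hamming_ball n r p \<inter> hamming_ball n r t) | p t.
            p \<in> sym_group n \<and> t \<in> sym_group n \<and> hamming_dist n p t \<ge> 2}"
  then obtain p t where c: "c = card (hamming_ball n r p \<inter> hamming_ball n r t)"
    and pt: "p permutes {1..n}" "t permutes {1..n}" and d: "hamming_dist n p t \<ge> 2"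
    by (auto simp: sym_group_def)
  have "{i \<in> {1..n}. p i \<noteq> t i} \<noteq> {}"
    using d hamming_dist_eq[OF pt(2), of p] by (metis card.empty not_numeral_le_zero)
  then have "\<exists>i\<in>{1..n}. (inv p \<circ> t) i \<noteq> i"
    using permutes_inv_eq[OF pt(1)] by fastforce
  then have "card (common_ball {1..n} r (inv p \<circ> t)) \<le> ?N"
    using card_common_ball_le[of "{1..n}" "inv p \<circ> t" r] r
      permutes_compose[OF pt(2) permutes_inv[OF pt(1)]] by simp
  then show "c \<le> ?N" unfolding c using card_hamming_ball_inter_le[OF pt(1), of r t] by linarith
next
  \<comment> \<open>The maximum is attained at the identity and this swap, whose distance is
    2.\<close>
  let ?t = "transpose 1 2 :: nat \<Rightarrow> nat"
  have t: "?t permutes {1..n}" using n by (intro permutes_swap_id) auto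
  have "hamming_ball n r id \<inter> hamming_ball n r ?t = common_ball {1..n} r ?t"
  proof -
    have "id i \<noteq> q i \<longleftrightarrow> q i \<noteq> i" "?t i \<noteq> q i \<longleftrightarrow> q i \<noteq> ?t i" for q and i :: nat by auto
    then show ?thesis unfolding hamming_ball_eq common_ball_def by (simp add: Collect_conj_eq Int_ac)
  qed
  then have card: "card (hamming_ball n r id \<inter> hamming_ball n r ?t) = ?N"
    using card_common_ball_transpose[of "{1..n}" 1 2 r] card_off_pair_ball_eq_sum[of "{1..n}" 1 2 r] n r
    by simp
  have sub: "{1, 2} \<subseteq> {i \<in> {1..n}. id i \<noteq> ?t i}" using n by auto
  have "hamming_dist n id ?t \<ge> 2"
    unfolding hamming_dist_eq[OF t] using card_mono[OF _ sub] by simp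
  then show "?N \<in> {card (hamming_ball n r p \<inter> hamming_ball n r t) | p t.
            p \<in> sym_group n \<and> t \<in> sym_group n \<and> hamming_dist n p t \<ge> 2}"
    using card t permutes_id[of "{1..n}"] unfolding sym_group_def mem_Collect_eq by metis
qed

section \<open>Explicit polynomials\<close>

theorem theorem1p1:
  shows "(\<forall>n::nat. n \<ge> 5 \<longrightarrow>
            real (max_ball_inter n 5) =
              32/3 * real n ^ 3 - 89 * real n ^ 2 + 739/3 * real n - 220)
       \<and> (\<forall>n::nat. n \<ge> 6 \<longrightarrow>
            real (max_ball_inter n 6) =
              181/12 * real n ^ 4 - 401/2 * real n ^ 3 + 11783/12 * real n ^ 2
                - 4153/2 * real n + 1590)
       \<and> (\<forall>n::nat. n \<ge> 7 \<longrightarrow>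
            real (max_ball_inter n 7) =
              607/30 * real n ^ 5 - 4675/12 * real n ^ 4 + 8807/3 * real n ^ 3
                - 129041/12 * real n ^ 2 + 190471/10 * real n - 12978)"
proof -
  have e: "partial_derangements 2 0 = 2" "partial_derangements 3 (Suc 0) = 4"
    "partial_derangements 4 2 = 14" "partial_derangements 5 3 = 64"
    "partial_derangements 6 4 = 362" "partial_derangements 7 5 = 2428"
    by (simp_all add: partial_derangements_numeral fact_numeral)
  \<comment> \<open>Valid for every \<open>m\<close>: when \<open>m\<close> is too small, one of the
    factors vanishes.\<close>
  have b: "real (m choose 2) = real m * (real m - 1) / 2"
    "real (m choose 3) = real m * (real m - 1) * (real m - 2) / 6"
    "real (m choose 4) = real m * (real m - 1) * (real m - 2) * (real m - 3) / 24"
    "real (m choose 5) = real m * (real m - 1) * (real m - 2) * (real m - 3) * (real m - 4) / 120"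
    for m :: nat
    by (simp_all add: binomial_gbinomial gbinomial_prod_rev numeral_eq_Suc field_simps)
  have range: "{..3} = {0, 1, 2, 3 :: nat}" "{..4} = {0, 1, 2, 3, 4 :: nat}"
    "{..5} = {0, 1, 2, 3, 4, 5 :: nat}"
    by auto
  show ?thesis
  proof (intro conjI allI impI)
    fix n :: nat assume "n \<ge> 5"
    \<comment> \<open>Writing \<open>n\<close> as \<open>m + 2\<close> removes the truncated
      subtraction in \<open>(n - 2) choose k\<close>, so that both sides become polynomials in
      \<open>real m\<close>.\<close>
    then obtain m where m: "n = m + 2" using le_Suc_ex[of 2 n] by (auto simp: add.commute)
    show "real (max_ball_inter n 5) =
              32/3 * real n ^ 3 - 89 * real n ^ 2 + 739/3 * real n - 220"
      unfolding m by (simp add: max_ball_inter_eq_sum range e b field_simps power_numeral_reduce)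
  next
    fix n :: nat assume "n \<ge> 6"
    then obtain m where m: "n = m + 2" using le_Suc_ex[of 2 n] by (auto simp: add.commute)
    show "real (max_ball_inter n 6) =
              181/12 * real n ^ 4 - 401/2 * real n ^ 3 + 11783/12 * real n ^ 2
                - 4153/2 * real n + 1590"
      unfolding m by (simp add: max_ball_inter_eq_sum range e b field_simps power_numeral_reduce)
  next
    fix n :: nat assume "n \<ge> 7"
    then obtain m where m: "n = m + 2" using le_Suc_ex[of 2 n] by (auto simp: add.commute)
    show "real (max_ball_inter n 7) =
              607/30 * real n ^ 5 - 4675/12 * real n ^ 4 + 8807/3 * real n ^ 3
                - 129041/12 * real n ^ 2 + 190471/10 * real n - 12978"
      unfolding m by (simp add: max_ball_inter_eq_sum range e b field_simps power_numeral_reduce)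
  qed
qed

end
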